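(* Let $n\ge 2$ and let $D\subsetneq\mathbb{R}^n$ be a convex domain. Then for all $x,y\in D$, $$u_D(x,y)\le 3\,\alpha_D(x,y),$$ and the inequality is sharp, i.e. the constant $3$ cannot be replaced by any smaller constant valid for all convex domains $D\subsetneq\mathbb{R}^n$ and all $x,y\in D$.
   Context: A domain is a nonempty open connected set. For a domain $D\subsetneq\mathbb{R}^n$ and $x\in D$, $d(x)$ denotes the Euclidean distance from $x$ to the boundary of $D$ in $\mathbb{R}^n$. The Gromov hyperbolic metric $u_D$ is $$u_D(x,y)=2\log\frac{|x-y|+\max\{d(x),d(y)\}}{\sqrt{d(x)\,d(y)}},\qquad x,y\in D.$$ Let $\overline{\mathbb{R}}^n=\mathbb{R}^n\cup\{\infty\}$. For a proper open subset $D$ of $\overline{\mathbb{R}}^n$, with boundary $\partial D$ taken in $\overline{\mathbb{R}}^n$, the Apollonian metric is $$\alpha_D(x,y)=\sup_{p,q\in\partial D}\log|p,x,y,q|,\qquad |p,x,y,q|=\frac{|p-y|\,|x-q|}{|p-x|\,|y-q|},\qquad x,y\in D,$$ where a quotient of two distances to $\infty$ is interpreted as $1$ (e.g. $\frac{|\infty-y|}{|\infty-x|}=1$). *)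

theory Defs
  imports "HOL-Analysis.Analysis"
begin

definition is_domain :: "'a::topological_space set \<Rightarrow> bool" where
  "is_domain D \<longleftrightarrow> D \<noteq> {} \<and> open D \<and> connected D"

definition boundary_dist :: "'a::metric_space set \<Rightarrow> 'a \<Rightarrow> real" where
  "boundary_dist D x = infdist x (frontier D)"

definition gromov_metric :: "'a::metric_space set \<Rightarrow> 'a \<Rightarrow> 'a \<Rightarrow> real" where
  "gromov_metric D x y =
     2 * ln ((dist x y + max (boundary_dist D x) (boundary_dist D y)) /
             sqrt (boundary_dist D x * boundary_dist D y))"

(* The extended space is the one-point compactification on the option type,
   with None as the point at infinity. *)

definition ext_boundary :: "'a::topological_space option set \<Rightarrow> 'a option set" where
  "ext_boundary D = Alexandroff_compactification euclidean frontier_of D"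

(* In a cross ratio each point contributes one distance to the numerator and one to the
   denominator, so giving every distance to infinity the value 1 realises the convention that
   a quotient of two such distances is 1.  On its own this function is not a metric. *)

fun ext_dist :: "'a::metric_space option \<Rightarrow> 'a option \<Rightarrow> real" where
  "ext_dist (Some a) (Some b) = dist a b"
| "ext_dist _ _ = 1"

definition cross_ratio ::
  "'a::metric_space option \<Rightarrow> 'a option \<Rightarrow> 'a option \<Rightarrow> 'a option \<Rightarrow> real" where
  "cross_ratio p x y q = (ext_dist p y * ext_dist x q) / (ext_dist p x * ext_dist y q)"

definition apollonian_metric ::
  "'a::metric_space option set \<Rightarrow> 'a option \<Rightarrow> 'a option \<Rightarrow> real" where
  "apollonian_metric D x y =
     (SUP (p, q) \<in> ext_boundary D \<times> ext_boundary D. ln (cross_ratio p x y q))"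

lemma ext_boundary_Some:
  fixes D :: "'a::euclidean_space set"
  assumes "open D"
  shows "ext_boundary (Some ` D) = Some ` frontier D \<union> (if bounded D then {} else {None})"
proof -
  let ?X = "Alexandroff_compactification (euclidean :: 'a topology)"
  have int: "?X interior_of (Some ` D) = Some ` D"
    using assms by (simp add: interior_of_openin)
  have S: "Some a \<in> ?X closure_of (Some ` D) \<longleftrightarrow> a \<in> closure D" for a
  proof -
    have "closure D = euclidean closure_of D" by simp
    moreover have "Some a \<in> ?X closure_of (Some ` D) \<longleftrightarrow> a \<in> euclidean closure_of D"
    proof
      assume L: "Some a \<in> ?X closure_of (Some ` D)"
      show "a \<in> euclidean closure_of D"
        unfolding in_closure_of
      proof (intro conjI allI impI)
        fix T :: "'a set" assume "a \<in> T \<and> openin euclidean T"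
        then have "Some a \<in> Some ` T" "openin ?X (Some ` T)" by auto
        with L obtain z where "z \<in> Some ` D" "z \<in> Some ` T"
          unfolding in_closure_of by blast
        then show "\<exists>y. y \<in> D \<and> y \<in> T" by auto
      qed simp
    next
      assume R: "a \<in> euclidean closure_of D"
      then show "Some a \<in> ?X closure_of (Some ` D)"
        using continuous_map_image_closure_subset[OF continuous_map_Some, of euclidean D] by blast
    qed
    ultimately show ?thesis by simp
  qed
  have N: "None \<in> ?X closure_of (Some ` D) \<longleftrightarrow> \<not> bounded D"
  proof
    assume L: "None \<in> ?X closure_of (Some ` D)"
    show "\<not> bounded D"
    proof
      assume "bounded D"
      then have K: "compact (closure D)" by simp
      let ?T = "insert None (Some ` (- closure D))"
      have "openin ?X ?T"
        unfolding openin_Alexandroff_compactification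
        using K by (intro disjI2 exI[of _ "closure D"]) (simp add: Compl_eq_Diff_UNIV)
      with L obtain z where "z \<in> Some ` D" "z \<in> ?T" unfolding in_closure_of by blast
      then show False using closure_subset by auto
    qed
  next
    assume R: "\<not> bounded D"
    show "None \<in> ?X closure_of (Some ` D)"
      unfolding in_closure_of
    proof (intro conjI allI impI)
      fix T assume T: "None \<in> T \<and> openin ?X T"
      then obtain C where C: "compact C" "T = insert None (Some ` (UNIV - C))"
        by (auto simp: openin_Alexandroff_compactification)
      have "\<not> D \<subseteq> C" using R C compact_imp_bounded bounded_subset by blast
      then show "\<exists>y. y \<in> Some ` D \<and> y \<in> T" using C by auto
    qed simp
  qed
  have "z \<in> ext_boundary (Some ` D) \<longleftrightarrow>
        z \<in> Some ` frontier D \<union> (if bounded D then {} else {None})" for z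
    using S N int assms by (cases z) (auto simp: ext_boundary_def frontier_of_def frontier_def interior_open)
  then show ?thesis by blast
qed

(* The supremum is over a nonempty set bounded above, so the conditionally complete SUP on the
   reals is the intended one. *)

lemma apollonian_SUP_proper:
  fixes D :: "'a::euclidean_space set"
  assumes "is_domain D" "D \<noteq> UNIV" "x \<in> D" "y \<in> D"
  shows "ext_boundary (Some ` D) \<noteq> {}"
    and "bdd_above ((\<lambda>(p, q). ln (cross_ratio p (Some x) (Some y) q)) `
           (ext_boundary (Some ` D) \<times> ext_boundary (Some ` D)))"
proof -
  have op: "open D" "D \<noteq> {}" using assms(1) by (auto simp: is_domain_def)
  then show "ext_boundary (Some ` D) \<noteq> {}"
    using assms(2) frontier_eq_empty by (auto simp: ext_boundary_Some)
  have notin: "a \<notin> D" if "Some a \<in> ext_boundary (Some ` D)" for a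
    using that op by (auto simp: ext_boundary_Some frontier_def interior_open split: if_splits)
  obtain e1 where e1: "e1 > 0" "ball x e1 \<subseteq> D" using op assms(3) open_contains_ball by blast
  obtain e2 where e2: "e2 > 0" "ball y e2 \<subseteq> D" using op assms(4) open_contains_ball by blast
  have pos: "ext_dist p (Some a) > 0"
    if "p \<in> ext_boundary (Some ` D)" "a \<in> D" for p a
    using that notin by (cases p) auto
  have sym: "ext_dist a b = ext_dist b a" for a b :: "'a option"
    by (cases a; cases b) (auto simp: dist_commute)
  have bound: "ext_dist p (Some b) \<le> (1 + dist a b / e) * ext_dist p (Some a)"
    if "p \<in> ext_boundary (Some ` D)" "e > 0" "ball a e \<subseteq> D" for p a b e
  proof (cases p)
    case (Some c)
    then have "c \<notin> ball a e" using that notin by blast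
    then have ge: "dist c a \<ge> e" by (simp add: dist_commute)
    have "dist c b \<le> dist c a + dist a b" by (rule dist_triangle)
    also have "dist a b \<le> dist a b / e * dist c a"
      using mult_right_mono[OF ge, of "dist a b"] \<open>e > 0\<close> by (simp add: field_simps)
    finally show ?thesis using Some by (simp add: algebra_simps)
  qed (use that in simp)
  show "bdd_above ((\<lambda>(p, q). ln (cross_ratio p (Some x) (Some y) q)) `
           (ext_boundary (Some ` D) \<times> ext_boundary (Some ` D)))"
  proof (rule bdd_aboveI2, clarify)
    fix p q assume pq: "p \<in> ext_boundary (Some ` D)" "q \<in> ext_boundary (Some ` D)"
    let ?A = "1 + dist x y / e1" and ?B = "1 + dist y x / e2"
    have "ext_dist p (Some y) * ext_dist q (Some x) \<le>
          (?A * ext_dist p (Some x)) * (?B * ext_dist q (Some y))"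
      using bound[OF pq(1) e1] bound[OF pq(2) e2] pos[OF pq(1)] pos[OF pq(2)] assms e1 e2
      by (intro mult_mono) (auto intro!: mult_nonneg_nonneg simp: less_imp_le)
    then have "cross_ratio p (Some x) (Some y) q \<le> ?A * ?B"
      using pos[OF pq(1) assms(3)] pos[OF pq(2) assms(4)]
      by (simp add: cross_ratio_def sym[of _ q] divide_le_eq algebra_simps)
    moreover have "cross_ratio p (Some x) (Some y) q > 0"
      using pos[OF pq(1)] pos[OF pq(2)] assms by (simp add: cross_ratio_def sym[of _ q])
    ultimately show "ln (cross_ratio p (Some x) (Some y) q) \<le> ln (?A * ?B)"
      by simp
  qed
qed

end

theory Submission
  imports Defs
begin

text \<open>
  The logarithm \<open>j(x,y) = ln (1 + |x-y| / min (d x) (d y))\<close> separates the two sides of the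
  inequality.

  In every domain the Gromov metric is at most \<open>3 j\<close> (\<open>gromov_metric_le_ln\<close>): with
  \<open>s = d x \<le> t = d y\<close> and \<open>r = |x-y|\<close> this says \<open>(r+t)\<^sup>2 s\<^sup>2 \<le> t (s+r)\<^sup>3\<close>, and
  \<open>s \<le> t \<le> s+r\<close> because the boundary distance is 1-Lipschitz.

  In a convex domain the Apollonian metric is at least \<open>j\<close> (\<open>apollonian_metric_ge_convex\<close>).
  The domain lies in the half-space \<open>H\<close> bounded by a supporting hyperplane at the boundary point
  nearest to \<open>x\<close>. The Apollonian metric grows when the domain shrinks, and that of \<open>H\<close> is the
  hyperbolic metric, which for given \<open>r\<close> and given height \<open>s\<close> of \<open>x\<close> over the hyperplane is
  smallest when \<open>y\<close> lies vertically above \<open>x\<close>; the value there is \<open>ln (1 + r/s)\<close>.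
  The monotonicity in the domain is made concrete as follows. For a point \<open>z\<close> outside \<open>D\<close> whose
  distance to \<open>y\<close> is \<open>K \<ge> 1\<close> times its distance to \<open>x\<close>, the segment from \<open>x\<close> to \<open>z\<close> meets the
  boundary of \<open>D\<close> in a point with at least the same ratio (\<open>frontier_point_ratio\<close>). Suitable points
  \<open>z\<close> are the lowest points of two Apollonius spheres (\<open>Apollonius_point_below\<close>); the ratios for
  which these spheres just reach the hyperplane solve quadratic equations, and their product is at
  least \<open>1 + r/s\<close> (\<open>apollonian_metric_ge_halfspace\<close>).

  The constant is attained in the limit by two points on a vertical line in a half-space, at heights
  \<open>1\<close> and \<open>1 + e\<close>: there the Apollonian metric is \<open>ln (1 + e)\<close>, about \<open>e\<close>, and the Gromov metric
  is \<open>2 ln (1 + 2e) - ln (1 + e)\<close>, about \<open>3e\<close>.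
\<close>

section \<open>Cross ratios bound the metric from below\<close>

lemma ext_dist_commute: "ext_dist a b = ext_dist b a"
  by (cases a; cases b) (auto simp: dist_commute)

lemma cross_ratio_swap: "cross_ratio p x y q = cross_ratio q y x p"
  by (simp add: cross_ratio_def ext_dist_commute mult.commute)

lemma gromov_metric_commute: "gromov_metric D x y = gromov_metric D y x"
  by (simp add: gromov_metric_def dist_commute max.commute mult.commute)

lemma apollonian_metric_commute: "apollonian_metric D x y = apollonian_metric D y x"
proof -
  let ?E = "ext_boundary D"
  have "(\<lambda>(p, q). ln (cross_ratio p x y q)) ` (?E \<times> ?E) =
        (\<lambda>(p, q). ln (cross_ratio p y x q)) ` (?E \<times> ?E)"
    by (auto simp: image_iff) (metis cross_ratio_swap)+
  then show ?thesis
    unfolding apollonian_metric_def by simp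
qed

lemma ext_dist_pos:
  fixes D :: "'a::euclidean_space set"
  assumes "open D" "p \<in> ext_boundary (Some ` D)" "a \<in> D"
  shows "ext_dist p (Some a) > 0"
proof (cases p)
  case (Some c)
  with assms have "c \<in> frontier D" by (auto simp: ext_boundary_Some split: if_splits)
  then have "c \<noteq> a" using assms by (auto simp: frontier_def interior_open)
  then show ?thesis using Some by simp
qed simp

lemma apollonian_metric_ge:
  fixes D :: "'a::euclidean_space set"
  assumes D: "is_domain D" "D \<noteq> UNIV" "x \<in> D" "y \<in> D"
    and p: "p \<in> ext_boundary (Some ` D)" "A * ext_dist p (Some x) \<le> ext_dist p (Some y)"
    and q: "q \<in> ext_boundary (Some ` D)" "B * ext_dist q (Some y) \<le> ext_dist q (Some x)"
    and AB: "0 < A" "0 < B"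
  shows "ln (A * B) \<le> apollonian_metric (Some ` D) (Some x) (Some y)"
proof -
  have op: "open D" using D by (simp add: is_domain_def)
  have pos: "0 < ext_dist p (Some x)" "0 < ext_dist q (Some y)"
    using ext_dist_pos[OF op] p q D by blast+
  have "(A * ext_dist p (Some x)) * (B * ext_dist q (Some y)) \<le>
        ext_dist p (Some y) * ext_dist q (Some x)"
    using p q pos AB by (intro mult_mono) (auto intro: order_trans[rotated])
  then have "A * B \<le> cross_ratio p (Some x) (Some y) q"
    using pos by (simp add: cross_ratio_def ext_dist_commute[of _ q] le_divide_eq algebra_simps)
  then have "ln (A * B) \<le> ln (cross_ratio p (Some x) (Some y) q)"
    using AB by (intro ln_mono) auto
  also have "\<dots> \<le> apollonian_metric (Some ` D) (Some x) (Some y)"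
    unfolding apollonian_metric_def
    using cSUP_upper[OF _ apollonian_SUP_proper(2)[OF D], of "(p, q)"] p q by simp
  finally show ?thesis .
qed

section \<open>From exterior points to boundary points\<close>

text \<open>
  On the way from \<open>z\<close> towards \<open>x\<close> the inequality persists: after a step of length \<open>l\<close> the left side
  has dropped by \<open>K l\<close>, the right side by at most \<open>l\<close>. The segment leaves \<open>D\<close> somewhere.
\<close>

lemma frontier_point_ratio:
  fixes D :: "'a::euclidean_space set"
  assumes "x \<in> D" "z \<notin> D" "1 \<le> K" "K * dist z x \<le> dist z y"
  shows "\<exists>p\<in>frontier D. K * dist p x \<le> dist p y"
proof -
  have "closed_segment x z \<inter> frontier D \<noteq> {}"
    using assms by (intro connected_Int_frontier) auto
  then obtain p where p: "p \<in> closed_segment x z" "p \<in> frontier D" by blast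
  have split: "dist z x = dist z p + dist p x"
    using p(1) by (metis between between_mem_segment dist_commute add.commute)
  have "dist z y \<le> dist z p + dist p y" by (rule dist_triangle)
  moreover have "dist z p \<le> K * dist z p"
    using assms(3) by (simp add: mult_le_cancel_right1)
  ultimately have "K * dist p x \<le> dist p y"
    using assms(4) split by (simp add: distrib_left)
  then show ?thesis using p by blast
qed

text \<open>
  For an unbounded domain the point at infinity has ratio one. A bounded domain does not contain the
  ray from \<open>x\<close> pointing away from \<open>y\<close>, all of whose points are closer to \<open>x\<close>.
\<close>

lemma ext_boundary_ratio_one:
  fixes D :: "'a::euclidean_space set"
  assumes "open D" "D \<noteq> UNIV" "x \<in> D"
  shows "\<exists>p\<in>ext_boundary (Some ` D). ext_dist p (Some x) \<le> ext_dist p (Some y)"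
proof (cases "bounded D")
  case True
  have "\<exists>z. z \<notin> D \<and> dist z x \<le> dist z y"
  proof (cases "x = y")
    case False
    obtain M where M: "\<And>w. w \<in> D \<Longrightarrow> norm w \<le> M" using True by (auto simp: bounded_iff)
    define t where "t = (M + norm x + 1) / norm (x - y)"
    define z where "z = x + t *\<^sub>R (x - y)"
    have nn: "0 \<le> M" using M[OF assms(3)] norm_ge_zero order_trans by blast
    then have t: "0 \<le> t" by (simp add: t_def)
    have "norm (t *\<^sub>R (x - y)) = M + norm x + 1"
      using False nn by (simp add: t_def)
    moreover have "norm (t *\<^sub>R (x - y)) \<le> norm z + norm x"
      unfolding z_def by (metis add_diff_cancel_left' norm_triangle_ineq4)
    ultimately have "z \<notin> D" using M[of z] by auto
    moreover have "z - y = (1 + t) *\<^sub>R (x - y)" by (simp add: z_def algebra_simps)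
    then have "dist z x \<le> dist z y"
      using t by (simp add: dist_norm z_def mult_right_mono)
    ultimately show ?thesis by blast
  qed (use assms in auto)
  then obtain z where "z \<notin> D" "1 * dist z x \<le> dist z y" by auto
  from frontier_point_ratio[OF assms(3) this(1) order_refl this(2)]
  show ?thesis using assms(1) by (auto simp: ext_boundary_Some)
next
  case False
  then have "None \<in> ext_boundary (Some ` D)" using assms by (simp add: ext_boundary_Some)
  then show ?thesis by force
qed

section \<open>Comparison with a half-space\<close>

text \<open>
  The points with distance ratio \<open>K\<close> form a sphere with centre \<open>x - (y - x) / (K\<^sup>2 - 1)\<close> and radius
  \<open>K |x-y| / (K\<^sup>2 - 1)\<close>. The last hypothesis says that its lowest point in the direction of \<open>v\<close> has
  height at most \<open>b\<close>.
\<close>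

lemma Apollonius_point_below:
  fixes x y v :: "'a::real_inner"
  assumes v: "norm v = 1" and K: "1 < K"
    and le: "(v \<bullet> x - b) * (K\<^sup>2 - 1) \<le> K * dist x y + v \<bullet> (y - x)"
  shows "\<exists>z. v \<bullet> z \<le> b \<and> dist z y = K * dist z x"
proof -
  define e where "e = y - x"
  define r where "r = norm e"
  define k where "k = K\<^sup>2 - 1"
  have k: "0 < k" using K by (simp add: k_def one_less_power)
  define z where "z = x - (1 / k) *\<^sub>R (e + (K * r) *\<^sub>R v)"
  have vv: "v \<bullet> v = 1" using v by (simp add: dot_square_norm)
  have "v \<bullet> z = v \<bullet> x - (v \<bullet> e + K * r) / k"
    by (simp add: z_def inner_diff_right inner_add_right vv)
  moreover have "v \<bullet> x - b \<le> (v \<bullet> e + K * r) / k"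
    using le k by (simp add: pos_le_divide_eq k_def e_def r_def dist_norm norm_minus_commute)
  ultimately have "v \<bullet> z \<le> b" by linarith
  have ee: "e \<bullet> e = r * r" by (simp add: r_def dot_square_norm power2_eq_square)
  have zx: "z - x = - ((1 / k) *\<^sub>R (e + (K * r) *\<^sub>R v))" by (simp add: z_def)
  have "z - y = - (1 / k) *\<^sub>R (k *\<^sub>R e + (e + (K * r) *\<^sub>R v))"
    using k by (simp add: z_def e_def scaleR_add_right)
  also have "k *\<^sub>R e + (e + (K * r) *\<^sub>R v) = K *\<^sub>R (K *\<^sub>R e + r *\<^sub>R v)"
    by (simp add: k_def algebra_simps power2_eq_square)
  finally have zy: "z - y = - (1 / k) *\<^sub>R (K *\<^sub>R (K *\<^sub>R e + r *\<^sub>R v))" .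
  have "(norm (K *\<^sub>R e + r *\<^sub>R v))\<^sup>2 = (norm (e + (K * r) *\<^sub>R v))\<^sup>2"
    unfolding power2_norm_eq_inner
    by (simp add: inner_add_left inner_add_right vv ee inner_commute)
  then have "norm (K *\<^sub>R e + r *\<^sub>R v) = norm (e + (K * r) *\<^sub>R v)"
    by (rule power2_eq_imp_eq) auto
  then have "dist z y = K * dist z x"
    using k K by (simp add: dist_norm zx zy)
  with \<open>v \<bullet> z \<le> b\<close> show ?thesis by blast
qed

text \<open>
  The case \<open>K = 1\<close>, where the Apollonius sphere degenerates to a hyperplane, has to be included:
  the extremal ratio at \<open>y\<close> equals one when \<open>y\<close> lies vertically above \<open>x\<close>, and the extremal
  boundary point of the half-space is then infinity.
\<close>

lemma ext_boundary_ratio_halfspace: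
  fixes D :: "'a::euclidean_space set"
  assumes "open D" "D \<noteq> UNIV" "x \<in> D" "norm v = 1" "D \<subseteq> {z. b < v \<bullet> z}" "1 \<le> K"
    and "(v \<bullet> x - b) * (K\<^sup>2 - 1) \<le> K * dist x y + v \<bullet> (y - x)"
  shows "\<exists>p\<in>ext_boundary (Some ` D). K * ext_dist p (Some x) \<le> ext_dist p (Some y)"
proof (cases "K = 1")
  case True
  then show ?thesis using ext_boundary_ratio_one assms by auto
next
  case False
  then obtain z where "v \<bullet> z \<le> b" and z: "dist z y = K * dist z x"
    using Apollonius_point_below assms by (metis less_eq_real_def)
  then have "z \<notin> D" using assms(5) by auto
  from frontier_point_ratio[OF assms(3) this assms(6), of y] z
  obtain p where "p \<in> frontier D" "K * dist p x \<le> dist p y" by auto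
  then show ?thesis using assms(1) by (auto simp: ext_boundary_Some)
qed

text \<open>
  For \<open>x\<close> and \<open>y\<close> at heights \<open>s\<close> and \<open>h\<close> above the hyperplane, the ratios \<open>A\<close> and \<open>B\<close> below are the
  positive solutions of \<open>s (A\<^sup>2 - 1) = A r + (h - s)\<close> and \<open>h (B\<^sup>2 - 1) = B r + (s - h)\<close>, the cases of
  equality in the hypothesis on \<open>K\<close> above, at \<open>x\<close> and with \<open>x\<close> and \<open>y\<close> exchanged.
  The logarithm of \<open>A B\<close> is the hyperbolic distance of \<open>x\<close> and \<open>y\<close> in the half-space. Since
  \<open>(r + E)\<^sup>2 = 2 r (r + E) + 4 s h\<close>, the inequality \<open>A B \<ge> 1 + r/s\<close> amounts to \<open>r + E \<ge> 2 h\<close>, that is,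
  to \<open>B \<ge> 1\<close>.
\<close>

lemma apollonian_metric_ge_halfspace:
  fixes D :: "'a::euclidean_space set"
  assumes D: "is_domain D" "D \<noteq> UNIV" "x \<in> D" "y \<in> D"
    and v: "norm v = 1" "D \<subseteq> {z. b < v \<bullet> z}"
  shows "ln (1 + dist x y / (v \<bullet> x - b)) \<le> apollonian_metric (Some ` D) (Some x) (Some y)"
proof -
  have op: "open D" using D by (simp add: is_domain_def)
  define s where "s = v \<bullet> x - b"
  define h where "h = v \<bullet> y - b"
  define r where "r = dist x y"
  define E where "E = sqrt (r\<^sup>2 + 4 * s * h)"
  have pos: "0 < s" "0 < h" "0 \<le> r" using v D by (auto simp: s_def h_def r_def)
  have "\<bar>v \<bullet> (y - x)\<bar> \<le> r"
    using Cauchy_Schwarz_ineq2[of v "y - x"] v by (simp add: r_def dist_norm norm_minus_commute)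
  then have hs: "\<bar>h - s\<bar> \<le> r" by (simp add: h_def s_def inner_diff_right)
  have E2: "E\<^sup>2 = r\<^sup>2 + 4 * s * h" using pos by (simp add: E_def)
  have E0: "0 \<le> E" by (simp add: E_def pos less_imp_le)
  have Eh: "2 * h - r \<le> E"
  proof (rule power2_le_imp_le[OF _ E0])
    have "0 \<le> h * (s + r - h)" using pos hs by (intro mult_nonneg_nonneg) auto
    then show "(2 * h - r)\<^sup>2 \<le> E\<^sup>2" unfolding E2 by (simp add: power2_eq_square algebra_simps)
  qed
  have Es: "2 * s - r \<le> E"
  proof (rule power2_le_imp_le[OF _ E0])
    have "0 \<le> s * (h + r - s)" using pos hs by (intro mult_nonneg_nonneg) auto
    then show "(2 * s - r)\<^sup>2 \<le> E\<^sup>2" unfolding E2 by (simp add: power2_eq_square algebra_simps)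
  qed
  define A where "A = (r + E) / (2 * s)"
  define B where "B = (r + E) / (2 * h)"
  have A1: "1 \<le> A" using Es pos by (simp add: A_def le_divide_eq)
  have B1: "1 \<le> B" using Eh pos by (simp add: B_def le_divide_eq)
  have rE: "(r + E)\<^sup>2 = 2 * r * (r + E) + 4 * s * h"
    using E2 by (simp add: power2_eq_square algebra_simps)
  have "s * (A\<^sup>2 - 1) = A * r + (h - s)"
  proof -
    have "s * A\<^sup>2 = (r + E)\<^sup>2 / (4 * s)"
      using pos by (simp add: A_def power_divide power2_eq_square)
    also have "\<dots> = A * r + h"
      unfolding rE A_def using pos by (simp add: field_simps)
    finally show ?thesis by (simp add: algebra_simps)
  qed
  then have "(v \<bullet> x - b) * (A\<^sup>2 - 1) \<le> A * dist x y + v \<bullet> (y - x)"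
    by (simp add: s_def h_def r_def inner_diff_right)
  from ext_boundary_ratio_halfspace[OF op D(2,3) v A1 this]
  obtain p where p: "p \<in> ext_boundary (Some ` D)"
      "A * ext_dist p (Some x) \<le> ext_dist p (Some y)" by blast
  have "h * (B\<^sup>2 - 1) = B * r + (s - h)"
  proof -
    have "h * B\<^sup>2 = (r + E)\<^sup>2 / (4 * h)"
      using pos by (simp add: B_def power_divide power2_eq_square)
    also have "\<dots> = B * r + s"
      unfolding rE B_def using pos by (simp add: field_simps)
    finally show ?thesis by (simp add: algebra_simps)
  qed
  then have "(v \<bullet> y - b) * (B\<^sup>2 - 1) \<le> B * dist y x + v \<bullet> (x - y)"
    by (simp add: s_def h_def r_def inner_diff_right dist_commute)
  from ext_boundary_ratio_halfspace[OF op D(2,4) v B1 this]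
  obtain q where q: "q \<in> ext_boundary (Some ` D)"
      "B * ext_dist q (Some y) \<le> ext_dist q (Some x)" by blast
  have "1 + r / s \<le> A * B"
  proof -
    have "4 * s * h * (1 + r / s) = 4 * s * h + 2 * r * (2 * h)"
      using pos by (simp add: field_simps)
    also have "\<dots> \<le> (r + E)\<^sup>2"
      unfolding rE using Eh pos mult_left_mono[of "2 * h" "r + E" "2 * r"] by auto
    also have "\<dots> = 4 * s * h * (A * B)"
      using pos by (simp add: A_def B_def power2_eq_square)
    finally show ?thesis using pos by (simp add: mult_le_cancel_left_pos)
  qed
  then have "ln (1 + r / s) \<le> ln (A * B)"
    using pos by (intro ln_mono) (auto intro: add_pos_nonneg)
  also have "\<dots> \<le> apollonian_metric (Some ` D) (Some x) (Some y)"
    using apollonian_metric_ge[OF D p q] A1 B1 by simp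
  finally show ?thesis by (simp add: r_def s_def)
qed

text \<open>
  The half-space is the one supporting \<open>D\<close> at a boundary point \<open>p\<close> nearest to \<open>x\<close>: the height of
  \<open>x\<close> above its boundary is at most \<open>|x-p|\<close>, and a smaller height gives a larger bound.
\<close>

lemma apollonian_metric_ge_convex:
  fixes D :: "'a::euclidean_space set"
  assumes D: "is_domain D" "D \<noteq> UNIV" "x \<in> D" "y \<in> D" and "convex D"
  shows "ln (1 + dist x y / boundary_dist D x)
           \<le> apollonian_metric (Some ` D) (Some x) (Some y)"
proof -
  have op: "open D" using D by (simp add: is_domain_def)
  have "frontier D \<noteq> {}" using D frontier_eq_empty by (auto simp: is_domain_def)
  then obtain p where p: "p \<in> frontier D" "boundary_dist D x = dist x p"
    using infdist_attains_inf[of "frontier D" x] by (auto simp: boundary_dist_def)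
  have "p \<notin> D" using p op by (simp add: frontier_def interior_open)
  then obtain a c where a: "a \<noteq> 0" "\<And>z. z \<in> D \<Longrightarrow> c \<le> a \<bullet> z" "a \<bullet> p \<le> c"
    using separating_hyperplane_sets[of "{p}" D] \<open>convex D\<close> D by fastforce
  define v where "v = a /\<^sub>R norm a"
  have v: "norm v = 1" using a by (simp add: v_def)
  have sub: "D \<subseteq> {z. v \<bullet> p < v \<bullet> z}"
  proof -
    have "D \<subseteq> {z. a \<bullet> z \<ge> a \<bullet> p}" using a by force
    then have "D \<subseteq> interior {z. a \<bullet> z \<ge> a \<bullet> p}" using op by (rule interior_maximal)
    then have "D \<subseteq> {z. a \<bullet> z > a \<bullet> p}" using a by simp
    then show ?thesis using a by (auto simp: v_def divide_simps)
  qed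
  have s: "0 < v \<bullet> x - v \<bullet> p" using sub D by auto
  have "v \<bullet> x - v \<bullet> p \<le> dist x p"
    using norm_cauchy_schwarz[of v "x - p"] v by (simp add: inner_diff_right dist_norm)
  then have "dist x y / boundary_dist D x \<le> dist x y / (v \<bullet> x - v \<bullet> p)"
    using s p by (intro divide_left_mono mult_pos_pos) auto
  then have "ln (1 + dist x y / boundary_dist D x) \<le> ln (1 + dist x y / (v \<bullet> x - v \<bullet> p))"
    using p by (intro ln_mono) (auto intro!: add_pos_nonneg simp: divide_nonneg_nonneg)
  also have "\<dots> \<le> apollonian_metric (Some ` D) (Some x) (Some y)"
    by (rule apollonian_metric_ge_halfspace[OF D v sub])
  finally show ?thesis .
qed

section \<open>The upper bound for the Gromov metric\<close>

lemma gromov_metric_le_ln: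
  fixes D :: "'a::euclidean_space set"
  assumes D: "is_domain D" "D \<noteq> UNIV" "x \<in> D" "y \<in> D"
    and le: "boundary_dist D x \<le> boundary_dist D y"
  shows "gromov_metric D x y \<le> 3 * ln (1 + dist x y / boundary_dist D x)"
proof -
  define s where "s = boundary_dist D x"
  define t where "t = boundary_dist D y"
  define r where "r = dist x y"
  have "frontier D \<noteq> {}" using D frontier_eq_empty by (auto simp: is_domain_def)
  moreover have "x \<notin> frontier D" using D by (auto simp: is_domain_def frontier_def interior_open)
  ultimately have s: "0 < s"
    by (simp add: s_def boundary_dist_def infdist_pos_not_in_closed)
  have st: "s \<le> t" using le by (simp add: s_def t_def)
  have ts: "t \<le> s + r"
    using infdist_triangle[of y "frontier D" x]
    by (simp add: s_def t_def r_def boundary_dist_def dist_commute)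
  have r: "0 \<le> r" by (simp add: r_def)
  have key: "(r + t)\<^sup>2 * s\<^sup>2 \<le> t * (s + r)^3"
  proof -
    \<comment> \<open>The expression is the difference of the two sides, written in terms that are nonnegative
      by \<open>s \<le> t \<le> s + r\<close>.\<close>
    have "0 \<le> s ^ 3 * (s + r - t) + s\<^sup>2 * (t - s) * (s + r - t) + 2 * s\<^sup>2 * r\<^sup>2 + s * r ^ 3
        + (t - s) * (3 * s * r\<^sup>2 + r ^ 3)"
      using s st ts r by (intro add_nonneg_nonneg mult_nonneg_nonneg zero_le_power) auto
    then show ?thesis by (simp add: algebra_simps power2_eq_square power3_eq_cube)
  qed
  have "gromov_metric D x y = ln (((r + t) / sqrt (s * t))\<^sup>2)"
    using st s r by (simp add: gromov_metric_def s_def t_def r_def ln_realpow max_def)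
  also have "((r + t) / sqrt (s * t))\<^sup>2 = (r + t)\<^sup>2 / (s * t)"
    using s st by (simp add: power_divide)
  also have "ln ((r + t)\<^sup>2 / (s * t)) \<le> ln ((1 + r / s) ^ 3)"
  proof (rule ln_mono)
    have "(1 + r / s) ^ 3 = (s + r) ^ 3 / s ^ 3"
      using s by (simp add: add_divide_distrib flip: power_divide)
    moreover have "(r + t)\<^sup>2 / (s * t) = ((r + t)\<^sup>2 * s\<^sup>2) / (s ^ 3 * t)"
      using s st by (simp add: power2_eq_square power3_eq_cube)
    moreover have "\<dots> \<le> (t * (s + r) ^ 3) / (s ^ 3 * t)"
      using key s st by (intro divide_right_mono) auto
    ultimately show "(r + t)\<^sup>2 / (s * t) \<le> (1 + r / s) ^ 3"
      using s st by simp
  qed (use s st r in \<open>auto intro!: divide_pos_pos mult_pos_pos\<close>)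
  also have "\<dots> = 3 * ln (1 + r / s)"
    using s r by (simp add: ln_realpow add_pos_nonneg)
  finally show ?thesis by (simp add: r_def s_def)
qed

lemma gromov_metric_le_apollonian_metric:
  fixes D :: "'a::euclidean_space set"
  assumes D: "is_domain D" "D \<noteq> UNIV" "convex D" "x \<in> D" "y \<in> D"
  shows "gromov_metric D x y \<le> 3 * apollonian_metric (Some ` D) (Some x) (Some y)"
proof -
  have *: "gromov_metric D x y \<le> 3 * apollonian_metric (Some ` D) (Some x) (Some y)"
    if "x \<in> D" "y \<in> D" "boundary_dist D x \<le> boundary_dist D y" for x y
    using gromov_metric_le_ln[of D x y] apollonian_metric_ge_convex[of D x y] D that by force
  show ?thesis
    using *[of x y] *[of y x] D
    by (metis linear gromov_metric_commute apollonian_metric_commute)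
qed

section \<open>Sharpness in a half-space\<close>

text \<open>
  Among the boundary points of the half-space, \<open>0\<close> has the largest ratio of the distances to
  \<open>(1 + e) v\<close> and \<open>v\<close>, namely \<open>1 + e\<close>, and infinity has the smallest one, namely \<open>1\<close>.
\<close>

lemma halfspace_metrics:
  fixes v :: "'a::euclidean_space"
  assumes v: "norm v = 1" and e: "0 < e"
  defines "H \<equiv> {z. 0 < v \<bullet> z}"
  shows "is_domain H" "H \<noteq> UNIV" "convex H" "v \<in> H" "(1 + e) *\<^sub>R v \<in> H"
    and "gromov_metric H v ((1 + e) *\<^sub>R v) = 2 * ln (1 + 2 * e) - ln (1 + e)"
    and "apollonian_metric (Some ` H) (Some v) (Some ((1 + e) *\<^sub>R v)) = ln (1 + e)"
proof -
  define y where "y = (1 + e) *\<^sub>R v"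
  have v0: "v \<noteq> 0" and vv: "v \<bullet> v = 1" using v by (auto simp: dot_square_norm)
  have op: "open H" unfolding H_def by (rule open_halfspace_gt)
  show "convex H" unfolding H_def by (rule convex_halfspace_gt)
  show "v \<in> H" "(1 + e) *\<^sub>R v \<in> H" using vv e by (auto simp: H_def)
  then show "is_domain H"
    using op \<open>convex H\<close> convex_connected by (auto simp: is_domain_def)
  show "H \<noteq> UNIV" by (auto simp: H_def set_eq_iff intro!: exI[of _ 0])
  have fr: "frontier H = {z. v \<bullet> z = 0}"
    using v0 frontier_halfspace_gt[of v 0] by (simp add: H_def)
  have bd: "boundary_dist H (k *\<^sub>R v) = k" if "0 \<le> k" for k
    unfolding boundary_dist_def
  proof (rule antisym)
    have "infdist (k *\<^sub>R v) (frontier H) \<le> dist (k *\<^sub>R v) 0"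
      by (rule infdist_le) (simp add: fr)
    then show "infdist (k *\<^sub>R v) (frontier H) \<le> k" using that v by simp
    have "k \<le> dist (k *\<^sub>R v) z" if "z \<in> frontier H" for z
      using norm_cauchy_schwarz[of v "k *\<^sub>R v - z"] v vv that
      by (simp add: fr inner_diff_right dist_norm)
    moreover have "0 \<in> frontier H" by (simp add: fr)
    then have "frontier H \<noteq> {}" by blast
    ultimately show "k \<le> infdist (k *\<^sub>R v) (frontier H)"
      by (simp add: infdist_notempty cINF_greatest)
  qed
  have dy: "dist v y = e"
  proof -
    have "v - y = - e *\<^sub>R v" by (simp add: y_def algebra_simps)
    then show ?thesis using v e by (simp add: dist_norm)
  qed
  have b1: "boundary_dist H v = 1" "boundary_dist H y = 1 + e"
    using bd[of 1] bd[of "1 + e"] e by (auto simp: y_def)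
  have "gromov_metric H v y = 2 * ln ((1 + 2 * e) / sqrt (1 + e))"
    using e by (simp add: gromov_metric_def b1 dy algebra_simps)
  also have "\<dots> = 2 * ln (1 + 2 * e) - ln (1 + e)"
    using e by (simp add: ln_div ln_sqrt)
  finally show "gromov_metric H v ((1 + e) *\<^sub>R v) = 2 * ln (1 + 2 * e) - ln (1 + e)"
    by (simp add: y_def)
  have D: "is_domain H" "H \<noteq> UNIV" "v \<in> H" "y \<in> H" by (fact | simp add: y_def)+
  have n2: "(dist z (k *\<^sub>R v))\<^sup>2 = z \<bullet> z + k\<^sup>2" if "z \<in> frontier H" for z k
    using that unfolding dist_norm power2_norm_eq_inner fr
    by (simp add: inner_diff_left inner_diff_right inner_commute vv power2_eq_square)
  have far: "ext_dist p (Some y) \<le> (1 + e) * ext_dist p (Some v)"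
    if "p \<in> ext_boundary (Some ` H)" for p
  proof (cases p)
    case (Some z)
    then have z: "z \<in> frontier H" using that op by (auto simp: ext_boundary_Some split: if_splits)
    have "(dist z y)\<^sup>2 \<le> ((1 + e) * dist z v)\<^sup>2"
    proof -
      have "1 * (z \<bullet> z) \<le> (1 + e)\<^sup>2 * (z \<bullet> z)" using e by (intro mult_right_mono) auto
      then show ?thesis
        using n2[OF z, of 1] n2[OF z, of "1 + e"]
        by (simp add: y_def power_mult_distrib distrib_left)
    qed
    then have "dist z y \<le> (1 + e) * dist z v"
      by (rule power2_le_imp_le) (use e in simp)
    then show ?thesis using Some by simp
  qed (use e in simp)
  have near: "ext_dist p (Some v) \<le> ext_dist p (Some y)"
    if "p \<in> ext_boundary (Some ` H)" for p
  proof (cases p)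
    case (Some z)
    then have z: "z \<in> frontier H" using that op by (auto simp: ext_boundary_Some split: if_splits)
    have "(dist z v)\<^sup>2 \<le> (dist z y)\<^sup>2"
      using n2[OF z, of 1] n2[OF z, of "1 + e"] e by (simp add: y_def)
    then have "dist z v \<le> dist z y"
      by (rule power2_le_imp_le) simp
    then show ?thesis using Some by simp
  qed simp
  have "apollonian_metric (Some ` H) (Some v) (Some y) \<le> ln (1 + e)"
    unfolding apollonian_metric_def
  proof (rule cSUP_least)
    show "ext_boundary (Some ` H) \<times> ext_boundary (Some ` H) \<noteq> {}"
      using apollonian_SUP_proper(1)[OF D] by simp
  next
    fix pq assume "pq \<in> ext_boundary (Some ` H) \<times> ext_boundary (Some ` H)"
    then obtain p q where pq: "pq = (p, q)" "p \<in> ext_boundary (Some ` H)"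
        "q \<in> ext_boundary (Some ` H)" by auto
    have pos: "0 < ext_dist p (Some v)" "0 < ext_dist q (Some v)"
        "0 < ext_dist p (Some y)" "0 < ext_dist q (Some y)"
      using ext_dist_pos[OF op] pq D by auto
    have "ext_dist p (Some y) * ext_dist q (Some v) \<le>
        ((1 + e) * ext_dist p (Some v)) * ext_dist q (Some y)"
      using far[OF pq(2)] near[OF pq(3)] pos e by (intro mult_mono) auto
    then have "cross_ratio p (Some v) (Some y) q \<le> 1 + e"
      using pos by (simp add: cross_ratio_def ext_dist_commute[of _ q] divide_le_eq algebra_simps)
    moreover have "0 < cross_ratio p (Some v) (Some y) q"
      using pos by (simp add: cross_ratio_def ext_dist_commute[of _ q])
    ultimately show "(case pq of (p, q) \<Rightarrow> ln (cross_ratio p (Some v) (Some y) q)) \<le> ln (1 + e)"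
      using pq by simp
  qed
  moreover have "ln (1 + e) \<le> apollonian_metric (Some ` H) (Some v) (Some y)"
    using apollonian_metric_ge_halfspace[OF D v, of 0] by (simp add: H_def dy vv)
  ultimately show "apollonian_metric (Some ` H) (Some v) (Some ((1 + e) *\<^sub>R v)) = ln (1 + e)"
    by (simp add: y_def)
qed

lemma ln_ratio_exceeds:
  fixes c :: real
  assumes "c < 3"
  shows "\<exists>e>0. c * ln (1 + e) < 2 * ln (1 + 2 * e) - ln (1 + e)"
proof -
  \<comment> \<open>By \<open>ln (1 + e) \<le> e\<close> and \<open>ln (1 + 2e) \<ge> 2e / (1 + 2e)\<close> it is enough that
    \<open>(c + 1) (1 + 2e) < 4\<close>; with \<open>c + 1 = 4 - 16 e\<close> the left side is \<open>4 - 8e - 32e\<^sup>2\<close>.\<close>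
  define e where "e = (3 - c) / 16"
  have e: "0 < e" using assms by (simp add: e_def)
  have c: "c = 3 - 16 * e" by (simp add: e_def field_simps)
  have lower: "2 * e / (1 + 2 * e) \<le> ln (1 + 2 * e)"
    using ln_le_minus_one[of "1 / (1 + 2 * e)"] e by (simp add: ln_div field_simps)
  have "(c + 1) * ln (1 + e) < 2 * ln (1 + 2 * e)"
  proof (cases "0 \<le> c + 1")
    case True
    have "0 < e * (8 + 32 * e)" using e by simp
    then have "(c + 1) * (1 + 2 * e) < 4"
      unfolding c by (simp add: algebra_simps)
    then have "(c + 1) * e < 2 * (2 * e / (1 + 2 * e))"
      using e by (simp add: pos_less_divide_eq)
    moreover have "(c + 1) * ln (1 + e) \<le> (c + 1) * e"
      using True e by (intro mult_left_mono ln_add_one_self_le_self) auto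
    ultimately show ?thesis using lower by linarith
  next
    case False
    then have "(c + 1) * ln (1 + e) < 0" using e by (simp add: mult_neg_pos)
    moreover have "0 < ln (1 + 2 * e)" using e by simp
    ultimately show ?thesis by linarith
  qed
  then show ?thesis using e by (intro exI[of _ e]) (simp add: algebra_simps)
qed

theorem theorem5p7:
  assumes "CARD('n::finite) \<ge> 2"
  shows "(\<forall>D :: (real ^ 'n) set. is_domain D \<and> D \<noteq> UNIV \<and> convex D \<longrightarrow>
            (\<forall>x\<in>D. \<forall>y\<in>D. gromov_metric D x y \<le>
               3 * apollonian_metric (Some ` D) (Some x) (Some y)))
       \<and> (\<forall>c::real. c < 3 \<longrightarrow>
            \<not> (\<forall>D :: (real ^ 'n) set. is_domain D \<and> D \<noteq> UNIV \<and> convex D \<longrightarrow>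
                 (\<forall>x\<in>D. \<forall>y\<in>D. gromov_metric D x y \<le>
                    c * apollonian_metric (Some ` D) (Some x) (Some y))))"
proof (intro conjI allI impI)
  fix c :: real assume "c < 3"
  then obtain e where e: "0 < e" "c * ln (1 + e) < 2 * ln (1 + 2 * e) - ln (1 + e)"
    using ln_ratio_exceeds by blast
  obtain v :: "real ^ 'n" where v: "norm v = 1" using norm_Basis SOME_Basis by blast
  note H = halfspace_metrics[OF v e(1)]
  show "\<not> (\<forall>D :: (real ^ 'n) set. is_domain D \<and> D \<noteq> UNIV \<and> convex D \<longrightarrow>
                 (\<forall>x\<in>D. \<forall>y\<in>D. gromov_metric D x y \<le>
                    c * apollonian_metric (Some ` D) (Some x) (Some y)))"
  proof
    assume "\<forall>D :: (real ^ 'n) set. is_domain D \<and> D \<noteq> UNIV \<and> convex D \<longrightarrow>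
                 (\<forall>x\<in>D. \<forall>y\<in>D. gromov_metric D x y \<le>
                    c * apollonian_metric (Some ` D) (Some x) (Some y))"
    then have "gromov_metric {z. 0 < v \<bullet> z} v ((1 + e) *\<^sub>R v) \<le>
        c * apollonian_metric (Some ` {z. 0 < v \<bullet> z}) (Some v) (Some ((1 + e) *\<^sub>R v))"
      using H(1-5) by blast
    then show False using e(2) unfolding H(6,7) by linarith
  qed
qed (use gromov_metric_le_apollonian_metric in blast)

end
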